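(* Let $T\in\ell_\infty^n\otimes\ell_\infty^m$ satisfy $\mathrm{rank}(T)\le r$. Then $$\|T\|\le\nu_1(T)\le K_G\sqrt r\,\|T\|.$$
   Context: $T\in X\otimes Y$ is viewed as a linear operator $X^*\to Y$ (here $\ell_1^n\to\ell_\infty^m$) and $\|T\|$ is its operator norm (here the largest absolute value of a matrix entry). The 1-nuclear norm is $\nu_1(T)=\inf\{\sum_{k=1}^\infty\|x_k\|_X\|y_k\|_Y:\ T=\sum_{k=1}^\infty x_k\otimes y_k\}$, which equals the projective tensor norm in finite dimensions. $K_G$ is the (real) Grothendieck constant, which satisfies $1.67\le K_G\le1.79$. *)

theory Defs
  imports "HOL-Analysis.Analysis"
begin

text \<open>
  An element of \<open>X \<otimes> Y\<close> with \<open>X = \<real>^n\<close>, \<open>Y = \<real>^m\<close> (each with some norm) is represented by the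
  \<open>m \<times> n\<close> matrix \<open>T\<close> of the corresponding operator \<open>X\<^sup>* \<rightarrow> Y\<close>, \<open>z \<mapsto> T *v z\<close>, where \<open>X\<^sup>*\<close> is identified
  with \<open>\<real>^n\<close> through the standard inner product. The library function \<open>infnorm\<close> is the norm of
  \<open>\<ell>\<^sub>\<infinity>\<close>, and the dual norm is \<open>l1_norm\<close>.
\<close>

definition l1_norm :: "real ^ 'n \<Rightarrow> real" where
  "l1_norm x = (\<Sum>i\<in>UNIV. \<bar>x $ i\<bar>)"

text \<open>The matrix of \<open>x \<otimes> y\<close>, that is, of the operator \<open>z \<mapsto> (x \<bullet> z) *\<^sub>R y\<close>.\<close>

definition tensor :: "real ^ 'n \<Rightarrow> real ^ 'm \<Rightarrow> real ^ 'n ^ 'm" where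
  "tensor x y = (\<chi> i j. y $ i * x $ j)"

text \<open>The norm of a linear operator between spaces carrying the norms \<open>N\<close> and \<open>N'\<close>.\<close>

definition operator_norm :: "('a \<Rightarrow> real) \<Rightarrow> ('b \<Rightarrow> real) \<Rightarrow> ('a \<Rightarrow> 'b) \<Rightarrow> real" where
  "operator_norm N N' f = Sup {N' (f z) | z. N z \<le> 1}"

text \<open>
  The 1-nuclear norm on \<open>X \<otimes> Y\<close>, where \<open>NX\<close> and \<open>NY\<close> are the norms of \<open>X\<close> and \<open>Y\<close>. Only
  representations with finite \<open>\<Sum>k. NX (x k) * NY (y k)\<close> are listed; the others contribute \<open>\<infinity>\<close> to
  the infimum. Since all norms on the matrix space are equivalent, it does not matter in which
  of them the tensor series converges.
\<close>

definition nuclear_norm ::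
  "(real ^ 'n \<Rightarrow> real) \<Rightarrow> (real ^ 'm \<Rightarrow> real) \<Rightarrow> real ^ 'n ^ 'm \<Rightarrow> real" where
  "nuclear_norm NX NY T =
     Inf {s. \<exists>x y. (\<lambda>k. tensor (x k) (y k)) sums T \<and> (\<lambda>k. NX (x k) * NY (y k)) sums s}"

text \<open>
  The inequality of Grothendieck with constant \<open>K\<close>. The \<open>m + n\<close> vectors \<open>u i\<close>, \<open>v j\<close> of a real
  Hilbert space span a finite-dimensional subspace, so Hilbert space is rendered as \<open>\<real>^d\<close> with
  \<open>d\<close> arbitrary; a vector of \<open>\<real>^d\<close> is a function on \<open>{..<d}\<close>.
\<close>

definition grothendieck_inequality :: "real \<Rightarrow> bool" where
  "grothendieck_inequality K \<longleftrightarrow>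
     (\<forall>(m::nat) (n::nat) (a :: nat \<Rightarrow> nat \<Rightarrow> real).
        (\<forall>s t :: nat \<Rightarrow> real. (\<forall>i<m. \<bar>s i\<bar> \<le> 1) \<longrightarrow> (\<forall>j<n. \<bar>t j\<bar> \<le> 1) \<longrightarrow>
            \<bar>\<Sum>i<m. \<Sum>j<n. a i j * s i * t j\<bar> \<le> 1) \<longrightarrow>
        (\<forall>(d::nat) (u :: nat \<Rightarrow> nat \<Rightarrow> real) (v :: nat \<Rightarrow> nat \<Rightarrow> real).
            (\<forall>i<m. L2_set (u i) {..<d} \<le> 1) \<longrightarrow> (\<forall>j<n. L2_set (v j) {..<d} \<le> 1) \<longrightarrow>
            \<bar>\<Sum>i<m. \<Sum>j<n. a i j * (\<Sum>k<d. u i k * v j k)\<bar> \<le> K))"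

definition grothendieck_constant :: real ("K\<^sub>G") where
  "K\<^sub>G = Inf {K. grothendieck_inequality K}"

end

theory Submission
  imports Defs
begin

text \<open>
  The norm of \<open>T : \<ell>\<^sub>1\<^sup>n \<rightarrow> \<ell>\<^sub>\<infinity>\<^sup>m\<close> is its largest entry in absolute value, and an entry of \<open>x \<otimes> y\<close>
  is at most the product of the two sup norms. Adding this up over a tensor series gives the lower
  bound on the nuclear norm (\<open>operator_norm_le_nuclear_norm\<close>).

  For the upper bound, let \<open>t\<close> be the norm of \<open>T\<close>. It suffices to write \<open>T\<^sub>i\<^sub>j = \<langle>u\<^sub>i, v\<^sub>j\<rangle>\<close> in a
  Euclidean space such that \<open>\<parallel>u\<^sub>i\<parallel> \<parallel>v\<^sub>j\<parallel>\<close> is at most (nearly) \<open>\<surd>r t\<close>. Indeed, by Hahn-Banach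
  separation, the inequality of Grothendieck is the dual form of the statement that a matrix
  of inner products of unit vectors is \<open>K\<close> times a convex combination of tensors \<open>x \<otimes> y\<close> with
  \<open>x\<close>, \<open>y\<close> in the unit balls of \<open>\<ell>\<^sub>\<infinity>\<close> (\<open>hilbert_matrix_in_tensor_hull\<close>).

  The factorization is the one that the theorem of John on ellipsoids provides, applied to the rows
  \<open>T\<^sub>i\<close>, which span a space of dimension at most \<open>r\<close>. Here it comes from a balanced design: for
  weights \<open>\<lambda>\<close> in the simplex let \<open>D = \<Sum>\<^sub>i \<lambda>\<^sub>i T\<^sub>i T\<^sub>i\<^sup>t + \<delta> I\<close>. The inner product defined by \<open>D\<close>
  gives \<open>T\<^sub>i\<^sub>j = \<langle>D\<^sup>-\<^sup>1 T\<^sub>i, e\<^sub>j\<rangle>\<^sub>D\<close>, the squared length of \<open>e\<^sub>j\<close> is an average of squared entries plus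
  \<open>\<delta>\<close>, and that of \<open>D\<^sup>-\<^sup>1 T\<^sub>i\<close> is the leverage score \<open>\<sigma>\<^sub>i = \<langle>T\<^sub>i, D\<^sup>-\<^sup>1 T\<^sub>i\<rangle>\<close>. The weighted mean
  \<open>\<Sum>\<^sub>i \<lambda>\<^sub>i \<sigma>\<^sub>i\<close> is the trace of \<open>D\<^sup>-\<^sup>1 (D - \<delta> I)\<close>, hence at most the rank
  (\<open>weighted_leverage_le_rank\<close>), and a Brouwer fixed point of the (perturbed) reweighting
  \<open>\<lambda>\<^sub>i \<mapsto> \<lambda>\<^sub>i \<sigma>\<^sub>i / \<Sum>\<^sub>k \<lambda>\<^sub>k \<sigma>\<^sub>k\<close> makes every \<open>\<sigma>\<^sub>i\<close> almost as small as the mean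
  (\<open>ex_balanced_design\<close>). The perturbations then tend to zero.

  Since \<open>K\<^sub>G\<close> is an infimum of real numbers, some finite constant has to be exhibited; this is
  \<open>grothendieck_inequality_128\<close>.
\<close>

section \<open>The inequality of Grothendieck with some constant\<close>

text \<open>
  A subset \<open>A\<close> of \<open>{..<d}\<close> encodes a choice of \<open>d\<close> signs, so that sums over \<open>Pow {..<d}\<close> are, up to
  the factor \<open>2 ^ d\<close>, expectations over independent random signs. Random signs replace Gaussian
  variables here: they also embed \<open>\<real>\<^sup>d\<close> isometrically into an \<open>L\<^sub>2\<close> space, they have comparable
  fourth moments, and this \<open>L\<^sub>2\<close> space is again finite-dimensional.
\<close>

definition rademacher_sum :: "nat \<Rightarrow> (nat \<Rightarrow> real) \<Rightarrow> nat set \<Rightarrow> real" where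
  "rademacher_sum d u A = (\<Sum>k<d. if k \<in> A then u k else - u k)"

lemma sum_Pow_lessThan_Suc:
  fixes f :: "nat set \<Rightarrow> real"
  shows "(\<Sum>A\<in>Pow {..<Suc d}. f A) = (\<Sum>A\<in>Pow {..<d}. f A + f (insert d A))"
proof -
  have inj: "inj_on (insert d) (Pow {..<d})"
    by (auto simp: inj_on_def)
  have "(\<Sum>A\<in>Pow {..<Suc d}. f A) = sum f (Pow {..<d} \<union> insert d ` Pow {..<d})"
    by (simp add: lessThan_Suc Pow_insert)
  also have "\<dots> = sum f (Pow {..<d}) + sum f (insert d ` Pow {..<d})"
    by (intro sum.union_disjoint) auto
  finally show ?thesis
    by (simp add: sum.reindex[OF inj] sum.distrib)
qed

lemma rademacher_sum_Suc:
  assumes "A \<subseteq> {..<d}"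
  shows "rademacher_sum (Suc d) u A = rademacher_sum d u A - u d"
    and "rademacher_sum (Suc d) u (insert d A) = rademacher_sum d u A + u d"
proof -
  have "d \<notin> A" using assms by auto
  then show "rademacher_sum (Suc d) u A = rademacher_sum d u A - u d"
    by (simp add: rademacher_sum_def)
  have "(\<Sum>k<d. if k \<in> insert d A then u k else - u k) = rademacher_sum d u A"
    unfolding rademacher_sum_def by (intro sum.cong) auto
  then show "rademacher_sum (Suc d) u (insert d A) = rademacher_sum d u A + u d"
    by (simp add: rademacher_sum_def)
qed

lemma rademacher_sum_product:
  "(\<Sum>A\<in>Pow {..<d}. rademacher_sum d u A * rademacher_sum d v A) = 2 ^ d * (\<Sum>k<d. u k * v k)"
proof (induction d)
  case 0
  then show ?case by (simp add: rademacher_sum_def)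
next
  case (Suc d)
  have "(\<Sum>A\<in>Pow {..<Suc d}. rademacher_sum (Suc d) u A * rademacher_sum (Suc d) v A)
      = (\<Sum>A\<in>Pow {..<d}. 2 * (rademacher_sum d u A * rademacher_sum d v A) + 2 * (u d * v d))"
    unfolding sum_Pow_lessThan_Suc
    by (intro sum.cong) (auto simp: rademacher_sum_Suc algebra_simps)
  then show ?case
    by (simp add: sum.distrib Suc.IH card_Pow flip: sum_distrib_left) (simp add: algebra_simps)
qed

text \<open>
  Conditioning on the last sign, \<open>(R - x)\<^sup>4 + (R + x)\<^sup>4 = 2 R\<^sup>4 + 12 x\<^sup>2 R\<^sup>2 + 2 x\<^sup>4\<close>. The constant 3 is
  that of a Gaussian variable and is what makes the right-hand side add up to a square.
\<close>

lemma rademacher_sum_fourth_moment: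
  "(\<Sum>A\<in>Pow {..<d}. rademacher_sum d u A ^ 4) \<le> 3 * 2 ^ d * (\<Sum>k<d. (u k)\<^sup>2)\<^sup>2"
proof (induction d)
  case 0
  then show ?case by (simp add: rademacher_sum_def)
next
  case (Suc d)
  let ?R = "rademacher_sum d u" and ?s = "\<Sum>k<d. (u k)\<^sup>2"
  have second: "(\<Sum>A\<in>Pow {..<d}. (?R A)\<^sup>2) = 2 ^ d * ?s"
    using rademacher_sum_product[of d u u] by (simp add: power2_eq_square)
  have "(\<Sum>A\<in>Pow {..<Suc d}. rademacher_sum (Suc d) u A ^ 4)
      = (\<Sum>A\<in>Pow {..<d}. 2 * ?R A ^ 4 + 12 * (u d)\<^sup>2 * (?R A)\<^sup>2 + 2 * u d ^ 4)"
    unfolding sum_Pow_lessThan_Suc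
    by (intro sum.cong)
       (auto simp: rademacher_sum_Suc power2_eq_square eval_nat_numeral algebra_simps)
  also have "\<dots> = 2 * (\<Sum>A\<in>Pow {..<d}. ?R A ^ 4) + 12 * (u d)\<^sup>2 * (2 ^ d * ?s)
      + 2 ^ d * (2 * u d ^ 4)"
    by (simp add: sum.distrib card_Pow second flip: sum_distrib_left)
  also have "\<dots> \<le> 2 * (3 * 2 ^ d * ?s\<^sup>2) + 12 * (u d)\<^sup>2 * (2 ^ d * ?s) + 2 ^ d * (6 * u d ^ 4)"
    using Suc.IH by (intro add_mono mult_left_mono) auto
  also have "\<dots> = 3 * 2 ^ Suc d * (?s + (u d)\<^sup>2)\<^sup>2"
    by (simp add: power2_eq_square eval_nat_numeral algebra_simps)
  finally show ?case by simp
qed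

definition bounded_bilinear_form :: "nat \<Rightarrow> nat \<Rightarrow> (nat \<Rightarrow> nat \<Rightarrow> real) \<Rightarrow> bool" where
  "bounded_bilinear_form m n a \<longleftrightarrow>
     (\<forall>s t :: nat \<Rightarrow> real. (\<forall>i<m. \<bar>s i\<bar> \<le> 1) \<longrightarrow> (\<forall>j<n. \<bar>t j\<bar> \<le> 1) \<longrightarrow>
        \<bar>\<Sum>i<m. \<Sum>j<n. a i j * s i * t j\<bar> \<le> 1)"

definition hilbert_bound :: "nat \<Rightarrow> nat \<Rightarrow> (nat \<Rightarrow> nat \<Rightarrow> real) \<Rightarrow> real \<Rightarrow> bool" where
  "hilbert_bound m n a C \<longleftrightarrow>
     (\<forall>(d::nat) (u :: nat \<Rightarrow> nat \<Rightarrow> real) (v :: nat \<Rightarrow> nat \<Rightarrow> real).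
        (\<forall>i<m. L2_set (u i) {..<d} \<le> 1) \<longrightarrow> (\<forall>j<n. L2_set (v j) {..<d} \<le> 1) \<longrightarrow>
        \<bar>\<Sum>i<m. \<Sum>j<n. a i j * (\<Sum>k<d. u i k * v j k)\<bar> \<le> C)"

lemma grothendieck_inequality_iff:
  "grothendieck_inequality K \<longleftrightarrow> (\<forall>m n a. bounded_bilinear_form m n a \<longrightarrow> hilbert_bound m n a K)"
  unfolding grothendieck_inequality_def bounded_bilinear_form_def hilbert_bound_def by blast

text \<open>
  The Hilbert space bound scales with the lengths of the vectors and is available for
  coordinates indexed by any finite set; it is used for vectors indexed by sign patterns.
\<close>

lemma hilbert_bound_finite_index:
  fixes U V :: "nat \<Rightarrow> 'k \<Rightarrow> real"
  assumes bd: "hilbert_bound m n a C" and "finite J" and "\<alpha> > 0" and "\<beta> > 0"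
    and U: "\<And>i. i < m \<Longrightarrow> L2_set (U i) J \<le> \<alpha>"
    and V: "\<And>j. j < n \<Longrightarrow> L2_set (V j) J \<le> \<beta>"
  shows "\<bar>\<Sum>i<m. \<Sum>j<n. a i j * (\<Sum>k\<in>J. U i k * V j k)\<bar> \<le> \<alpha> * \<beta> * C"
proof -
  obtain h where h: "bij_betw h {..<card J} J"
    using ex_bij_betw_nat_finite[OF \<open>finite J\<close>] by (auto simp: atLeast0LessThan)
  have L2: "L2_set (\<lambda>k. f (h k) / c) {..<card J} = L2_set f J / c" if "c > 0" for f and c :: real
  proof -
    have "L2_set (\<lambda>k. f (h k)) {..<card J} = L2_set f J"
      unfolding L2_set_def using sum.reindex_bij_betw[OF h, of "\<lambda>k. (f k)\<^sup>2"] by simp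
    then show ?thesis
      using that L2_set_left_distrib[of "1 / c" "\<lambda>k. f (h k)" "{..<card J}"] by simp
  qed
  have reindex: "(\<Sum>k<card J. U i (h k) / \<alpha> * (V j (h k) / \<beta>))
      = (\<Sum>k\<in>J. U i k * V j k) / (\<alpha> * \<beta>)" for i j
    using sum.reindex_bij_betw[OF h, of "\<lambda>k. U i k * V j k"]
    by (simp flip: sum_divide_distrib)
  have "\<bar>\<Sum>i<m. \<Sum>j<n. a i j * (\<Sum>k<card J. U i (h k) / \<alpha> * (V j (h k) / \<beta>))\<bar> \<le> C"
    using bd[unfolded hilbert_bound_def, rule_format,
        of "\<lambda>i k. U i (h k) / \<alpha>" "card J" "\<lambda>j k. V j (h k) / \<beta>"] U V \<open>\<alpha> > 0\<close> \<open>\<beta> > 0\<close>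
    by (simp add: L2)
  then have "\<bar>(\<Sum>i<m. \<Sum>j<n. a i j * (\<Sum>k\<in>J. U i k * V j k)) / (\<alpha> * \<beta>)\<bar> \<le> C"
    unfolding reindex by (simp only: times_divide_eq_right flip: sum_divide_distrib)
  then show ?thesis
    using \<open>\<alpha> > 0\<close> \<open>\<beta> > 0\<close> by (simp add: abs_mult field_simps)
qed

lemma bounded_bilinear_form_scaled:
  assumes "bounded_bilinear_form m n a" and "b > 0" and "c > 0"
    and s: "\<And>i. i < m \<Longrightarrow> \<bar>s i\<bar> \<le> b" and t: "\<And>j. j < n \<Longrightarrow> \<bar>t j\<bar> \<le> c"
  shows "\<bar>\<Sum>i<m. \<Sum>j<n. a i j * (s i * t j)\<bar> \<le> b * c"
proof -
  have "\<bar>\<Sum>i<m. \<Sum>j<n. a i j * (s i / b) * (t j / c)\<bar> \<le> 1"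
    using assms(1)[unfolded bounded_bilinear_form_def, rule_format, of "\<lambda>i. s i / b" "\<lambda>j. t j / c"]
      s t \<open>b > 0\<close> \<open>c > 0\<close> by simp
  then have "\<bar>(\<Sum>i<m. \<Sum>j<n. a i j * (s i * t j)) / (b * c)\<bar> \<le> 1"
    by (simp add: sum_divide_distrib mult.assoc)
  then show ?thesis
    using \<open>b > 0\<close> \<open>c > 0\<close> by (simp add: abs_mult field_simps)
qed

text \<open>
  Any threshold above \<open>4 \<surd>3\<close> serves: by the fourth moment bound, the truncation error then has an
  \<open>L\<^sub>2\<close> norm at most \<open>1/4\<close>, and the two error terms below add up to half of the original bound.
\<close>

definition truncate :: "real \<Rightarrow> real" where
  "truncate x = (if \<bar>x\<bar> \<le> 8 then x else 0)"

lemma truncate_le: "\<bar>truncate x\<bar> \<le> 8" and truncate_le_self: "\<bar>truncate x\<bar> \<le> \<bar>x\<bar>"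
  by (auto simp: truncate_def)

text \<open>
  An error occurs only where \<open>\<bar>x\<bar> > 8\<close>, and there \<open>x\<^sup>2 \<le> x\<^sup>2 (x / 8)\<^sup>2\<close>.
\<close>

lemma truncation_error: "(x - truncate x)\<^sup>2 \<le> x ^ 4 / 64"
proof (cases "\<bar>x\<bar> \<le> 8")
  case False
  then have "8\<^sup>2 \<le> x\<^sup>2" by (intro abs_le_square_iff[THEN iffD1]) auto
  then have "x\<^sup>2 * 8\<^sup>2 \<le> x\<^sup>2 * x\<^sup>2" by (intro mult_left_mono) auto
  with False show ?thesis by (simp add: truncate_def flip: power_add)
qed (simp add: truncate_def)

text \<open>
  Represent \<open>\<langle>u\<^sub>i, v\<^sub>j\<rangle>\<close> as the mean of \<open>X\<^sub>i Y\<^sub>j\<close> for Rademacher sums \<open>X\<^sub>i\<close>, \<open>Y\<^sub>j\<close> and truncate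
  both at height 8. The truncated variables are bounded by 8 at every sign pattern, so the scalar
  hypothesis bounds their contribution by \<open>64\<close>. The truncation errors are vectors of length at most
  \<open>1/4\<close>, so the known Hilbert space bound \<open>C\<close> contributes at most \<open>C / 4\<close> for each of them.
\<close>

lemma hilbert_bound_improve:
  assumes form: "bounded_bilinear_form m n a" and bd: "hilbert_bound m n a C"
  shows "hilbert_bound m n a (64 + C / 2)"
  unfolding hilbert_bound_def
proof (intro allI impI)
  fix d :: nat and u v :: "nat \<Rightarrow> nat \<Rightarrow> real"
  assume u: "\<forall>i<m. L2_set (u i) {..<d} \<le> 1" and v: "\<forall>j<n. L2_set (v j) {..<d} \<le> 1"
  let ?J = "Pow {..<d}" and ?R = "rademacher_sum d"
  \<comment> \<open>Sums over sign patterns are not divided by \<open>2 ^ d\<close>, so unit vectors become vectors of length \<open>\<alpha>\<close>.\<close>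
  define \<alpha> :: real where "\<alpha> = sqrt (2 ^ d)"
  have "\<alpha> > 0" and \<alpha>2: "\<alpha> * \<alpha> = 2 ^ d" by (auto simp: \<alpha>_def)
  define B where "B U V = (\<Sum>i<m. \<Sum>j<n. a i j * (\<Sum>A\<in>?J. U i A * V j A))"
    for U V :: "nat \<Rightarrow> nat set \<Rightarrow> real"
  have sumsq: "(\<Sum>k<d. (w k)\<^sup>2) \<le> 1" if "L2_set w {..<d} \<le> 1" for w
    using that by (simp add: L2_set_def)
  have R2: "L2_set (?R w) ?J \<le> \<alpha>" if "L2_set w {..<d} \<le> 1" for w
  proof -
    have "(\<Sum>A\<in>?J. (?R w A)\<^sup>2) = 2 ^ d * (\<Sum>k<d. (w k)\<^sup>2)"
      using rademacher_sum_product[of d w w] by (simp add: power2_eq_square)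
    also have "\<dots> \<le> 2 ^ d" using sumsq[OF that] by simp
    finally show ?thesis by (simp add: L2_set_def \<alpha>_def)
  qed
  have trunc2: "L2_set (\<lambda>A. truncate (?R w A)) ?J \<le> \<alpha>" if "L2_set w {..<d} \<le> 1" for w
  proof -
    have "L2_set (\<lambda>A. truncate (?R w A)) ?J \<le> L2_set (?R w) ?J"
      unfolding L2_set_def using truncate_le_self
      by (intro real_sqrt_le_mono sum_mono) (simp add: abs_le_square_iff)
    with R2[OF that] show ?thesis by linarith
  qed
  have err2: "L2_set (\<lambda>A. ?R w A - truncate (?R w A)) ?J \<le> \<alpha> / 4"
    if "L2_set w {..<d} \<le> 1" for w
  proof -
    have "(\<Sum>A\<in>?J. (?R w A - truncate (?R w A))\<^sup>2) \<le> (\<Sum>A\<in>?J. ?R w A ^ 4) / 64"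
      unfolding sum_divide_distrib by (intro sum_mono truncation_error)
    also have "\<dots> \<le> 3 * 2 ^ d * (\<Sum>k<d. (w k)\<^sup>2)\<^sup>2 / 64"
      using rademacher_sum_fourth_moment by (intro divide_right_mono) auto
    also have "\<dots> \<le> 3 * 2 ^ d * 1 / 64"
      using sumsq[OF that] by (intro divide_right_mono mult_left_mono power_le_one sum_nonneg) auto
    also have "\<dots> \<le> (\<alpha> / 4)\<^sup>2" using \<alpha>2 by (simp add: power2_eq_square)
    finally show ?thesis
      using \<open>\<alpha> > 0\<close> unfolding L2_set_def by (intro real_le_lsqrt) auto
  qed
  let ?X = "\<lambda>i A. truncate (?R (u i) A)" and ?Y = "\<lambda>j A. truncate (?R (v j) A)"
  let ?X' = "\<lambda>i A. ?R (u i) A - ?X i A" and ?Y' = "\<lambda>j A. ?R (v j) A - ?Y j A"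
  have fin: "finite ?J" by simp
  have small1: "\<bar>B ?X ?Y'\<bar> \<le> \<alpha> * (\<alpha> / 4) * C"
    unfolding B_def using u v \<open>\<alpha> > 0\<close>
    by (intro hilbert_bound_finite_index[OF bd fin] trunc2 err2) auto
  have small2: "\<bar>B ?X' (\<lambda>j. ?R (v j))\<bar> \<le> (\<alpha> / 4) * \<alpha> * C"
    unfolding B_def using u v \<open>\<alpha> > 0\<close>
    by (intro hilbert_bound_finite_index[OF bd fin] R2 err2) auto
  have "B ?X ?Y = (\<Sum>A\<in>?J. \<Sum>i<m. \<Sum>j<n. a i j * (?X i A * ?Y j A))"
    unfolding B_def sum_distrib_left
    by (subst (2) sum.swap, subst sum.swap, rule refl)
  also have "\<bar>\<dots>\<bar> \<le> (\<Sum>A\<in>?J. \<bar>\<Sum>i<m. \<Sum>j<n. a i j * (?X i A * ?Y j A)\<bar>)"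
    by (rule sum_abs)
  also have "\<dots> \<le> (\<Sum>A\<in>?J. 8 * 8)"
    by (intro sum_mono bounded_bilinear_form_scaled[OF form] truncate_le) auto
  also have "\<dots> = 64 * 2 ^ d" by (simp add: card_Pow)
  finally have large: "\<bar>B ?X ?Y\<bar> \<le> 64 * 2 ^ d" .
  have "2 ^ d * (\<Sum>i<m. \<Sum>j<n. a i j * (\<Sum>k<d. u i k * v j k))
      = B (\<lambda>i. ?R (u i)) (\<lambda>j. ?R (v j))"
    unfolding B_def rademacher_sum_product by (simp add: sum_distrib_left mult_ac)
  also have "\<dots> = B ?X ?Y + B ?X ?Y' + B ?X' (\<lambda>j. ?R (v j))"
    unfolding B_def
    by (simp add: right_diff_distrib left_diff_distrib sum_subtractf sum.distrib)
  finally have "\<bar>2 ^ d * (\<Sum>i<m. \<Sum>j<n. a i j * (\<Sum>k<d. u i k * v j k))\<bar> \<le> 2 ^ d * (64 + C / 2)"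
    using large small1 small2 \<alpha>2 by (simp add: algebra_simps)
  then show "\<bar>\<Sum>i<m. \<Sum>j<n. a i j * (\<Sum>k<d. u i k * v j k)\<bar> \<le> 64 + C / 2"
    by (simp add: abs_mult)
qed

lemma hilbert_bound_trivial: "hilbert_bound m n a (\<Sum>i<m. \<Sum>j<n. \<bar>a i j\<bar>)"
  unfolding hilbert_bound_def
proof (intro allI impI)
  fix d :: nat and u v :: "nat \<Rightarrow> nat \<Rightarrow> real"
  assume u: "\<forall>i<m. L2_set (u i) {..<d} \<le> 1" and v: "\<forall>j<n. L2_set (v j) {..<d} \<le> 1"
  have "\<bar>\<Sum>k<d. u i k * v j k\<bar> \<le> 1" if "i < m" "j < n" for i j
  proof -
    have "\<bar>\<Sum>k<d. u i k * v j k\<bar> \<le> (\<Sum>k<d. \<bar>u i k\<bar> * \<bar>v j k\<bar>)"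
      using sum_abs[of "\<lambda>k. u i k * v j k"] by (simp add: abs_mult)
    also have "\<dots> \<le> L2_set (u i) {..<d} * L2_set (v j) {..<d}" by (rule L2_set_mult_ineq)
    also have "\<dots> \<le> 1" using u v that by (intro mult_le_one) auto
    finally show ?thesis .
  qed
  then have "\<bar>a i j * (\<Sum>k<d. u i k * v j k)\<bar> \<le> \<bar>a i j\<bar>" if "i < m" "j < n" for i j
    using that by (simp add: abs_mult mult_left_le)
  then have "(\<Sum>i<m. \<Sum>j<n. \<bar>a i j * (\<Sum>k<d. u i k * v j k)\<bar>) \<le> (\<Sum>i<m. \<Sum>j<n. \<bar>a i j\<bar>)"
    by (intro sum_mono) auto
  moreover have "\<bar>\<Sum>i<m. \<Sum>j<n. a i j * (\<Sum>k<d. u i k * v j k)\<bar>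
      \<le> (\<Sum>i<m. \<Sum>j<n. \<bar>a i j * (\<Sum>k<d. u i k * v j k)\<bar>)"
    by (intro order_trans[OF sum_abs] sum_mono sum_abs)
  ultimately show "\<bar>\<Sum>i<m. \<Sum>j<n. a i j * (\<Sum>k<d. u i k * v j k)\<bar> \<le> (\<Sum>i<m. \<Sum>j<n. \<bar>a i j\<bar>)"
    by linarith
qed

text \<open>
  The map \<open>C \<mapsto> 64 + C / 2\<close> improves every Hilbert space bound and contracts towards its fixed point
  128. The starting point depends on the matrix, the limit does not.
\<close>

theorem grothendieck_inequality_128: "grothendieck_inequality 128"
  unfolding grothendieck_inequality_iff
proof (intro allI impI)
  fix m n a assume form: "bounded_bilinear_form m n a"
  define C0 where "C0 = (\<Sum>i<m. \<Sum>j<n. \<bar>a i j\<bar>)"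
  have iter: "hilbert_bound m n a (128 + C0 / 2 ^ k)" for k
  proof (induction k)
    case 0
    have "C0 \<le> 128 + C0 / 2 ^ 0" by simp
    with hilbert_bound_trivial[of m n a] show ?case
      unfolding hilbert_bound_def C0_def by (meson order_trans)
  next
    case (Suc k)
    have "64 + (128 + C0 / 2 ^ k) / 2 = 128 + C0 / 2 ^ Suc k" by (simp add: field_simps)
    then show ?case using hilbert_bound_improve[OF form Suc.IH] by (simp only:)
  qed
  have lim: "(\<lambda>k. 128 + C0 / 2 ^ k) \<longlonglongrightarrow> 128 + 0"
    by (intro tendsto_intros LIMSEQ_divide_realpow_zero) auto
  show "hilbert_bound m n a 128"
    unfolding hilbert_bound_def
  proof (intro allI impI)
    fix d :: nat and u v :: "nat \<Rightarrow> nat \<Rightarrow> real"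
    assume "\<forall>i<m. L2_set (u i) {..<d} \<le> 1" and "\<forall>j<n. L2_set (v j) {..<d} \<le> 1"
    then have "\<bar>\<Sum>i<m. \<Sum>j<n. a i j * (\<Sum>k<d. u i k * v j k)\<bar> \<le> 128 + C0 / 2 ^ k" for k
      using iter[of k] unfolding hilbert_bound_def by blast
    with LIMSEQ_le_const[OF lim]
    show "\<bar>\<Sum>i<m. \<Sum>j<n. a i j * (\<Sum>k<d. u i k * v j k)\<bar> \<le> 128" by auto
  qed
qed

section \<open>Entries, operator norm and tensor series\<close>

lemma infnorm_le_iff_cart: "infnorm (x :: real ^ 'n) \<le> c \<longleftrightarrow> (\<forall>i. \<bar>x $ i\<bar> \<le> c)"
proof
  show "\<forall>i. \<bar>x $ i\<bar> \<le> c" if "infnorm x \<le> c"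
    using that component_le_infnorm_cart order_trans by blast
  show "infnorm x \<le> c" if "\<forall>i. \<bar>x $ i\<bar> \<le> c"
    unfolding infnorm_cart using that by (intro cSup_least) auto
qed

lemma bounded_linear_entry: "bounded_linear (\<lambda>T :: real ^ 'n ^ 'm. T $ i $ j)"
  by (intro bounded_linear_compose[OF bounded_linear_vec_nth] bounded_linear_vec_nth)

text \<open>
  Each coordinate of \<open>T *v z\<close> averages the entries of a row, with weights of absolute sum \<open>\<le> 1\<close>.
\<close>

lemma l1_operator_infnorm_le:
  fixes T :: "real ^ 'n ^ 'm"
  assumes "\<And>i j. \<bar>T $ i $ j\<bar> \<le> t" and z: "l1_norm z \<le> 1"
  shows "infnorm (T *v z) \<le> t"
proof -
  have "0 \<le> t" using assms(1) abs_ge_zero order_trans by blast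
  have "\<bar>(T *v z) $ i\<bar> \<le> t" for i
  proof -
    have "\<bar>(T *v z) $ i\<bar> \<le> (\<Sum>j\<in>UNIV. \<bar>T $ i $ j\<bar> * \<bar>z $ j\<bar>)"
      unfolding matrix_vector_mult_def by (simp flip: abs_mult)
    also have "\<dots> \<le> (\<Sum>j\<in>UNIV. t * \<bar>z $ j\<bar>)" by (intro sum_mono mult_right_mono assms) auto
    also have "\<dots> = t * l1_norm z" by (simp add: l1_norm_def sum_distrib_left)
    also have "\<dots> \<le> t" using z \<open>0 \<le> t\<close> by (simp add: mult_left_le)
    finally show ?thesis .
  qed
  then show ?thesis by (simp add: infnorm_le_iff_cart)
qed

lemma operator_norm_l1_infnorm_le:
  fixes T :: "real ^ 'n ^ 'm"
  assumes "\<And>i j. \<bar>T $ i $ j\<bar> \<le> t"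
  shows "operator_norm l1_norm infnorm (\<lambda>z. T *v z) \<le> t"
proof -
  have "l1_norm (0 :: real ^ 'n) \<le> 1" by (simp add: l1_norm_def)
  then have "{infnorm (T *v z) | z. l1_norm z \<le> 1} \<noteq> {}" by blast
  then show ?thesis
    unfolding operator_norm_def using l1_operator_infnorm_le[OF assms] by (intro cSup_least) auto
qed

text \<open>
  The entries of column \<open>j\<close> are the coordinates of the image of the \<open>j\<close>-th unit vector.
\<close>

lemma entry_le_operator_norm_l1_infnorm:
  fixes T :: "real ^ 'n ^ 'm"
  shows "\<bar>T $ i $ j\<bar> \<le> operator_norm l1_norm infnorm (\<lambda>z. T *v z)"
proof -
  have "\<bar>T $ i $ j\<bar> \<le> norm T" for i j
    using component_le_norm_cart[of "T $ i" j] Finite_Cartesian_Product.norm_nth_le[of T i] by linarith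
  from l1_operator_infnorm_le[OF this]
  have "bdd_above {infnorm (T *v z) | z. l1_norm z \<le> 1}" by (auto intro!: bdd_aboveI)
  moreover have "l1_norm (axis j 1 :: real ^ 'n) \<le> 1" by (simp add: l1_norm_def axis_def if_distrib cong: if_cong)
  ultimately have "infnorm (T *v axis j 1) \<le> operator_norm l1_norm infnorm (\<lambda>z. T *v z)"
    unfolding operator_norm_def by (intro cSup_upper) auto
  moreover have "\<bar>T $ i $ j\<bar> \<le> infnorm (T *v axis j 1)"
    using component_le_infnorm_cart[of "T *v axis j 1" i]
    by (simp add: matrix_vector_mul_component inner_axis)
  ultimately show ?thesis by linarith
qed

lemma entry_le_tensor_series:
  fixes T :: "real ^ 'n ^ 'm"
  assumes T: "(\<lambda>k. tensor (x k) (y k)) sums T"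
    and s: "(\<lambda>k. infnorm (x k) * infnorm (y k)) sums s"
  shows "\<bar>T $ i $ j\<bar> \<le> s"
proof -
  have entry: "(\<lambda>k. y k $ i * x k $ j) sums (T $ i $ j)"
    using bounded_linear.sums[OF bounded_linear_entry[of i j] T] by (simp add: tensor_def)
  have le: "\<bar>y k $ i * x k $ j\<bar> \<le> infnorm (x k) * infnorm (y k)" for k
    unfolding abs_mult using component_le_infnorm_cart[of "x k"] component_le_infnorm_cart[of "y k"]
    by (subst mult.commute) (intro mult_mono infnorm_pos_le, auto)
  have "T $ i $ j \<le> s" using le by (intro sums_le[OF _ entry s]) (meson abs_le_iff)
  moreover have "- (T $ i $ j) \<le> s" using le by (intro sums_le[OF _ sums_minus[OF entry] s]) (meson abs_le_iff)
  ultimately show ?thesis by linarith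
qed

section \<open>Inner product matrices as convex combinations of elementary tensors\<close>

lemma grothendieck_inequality_ge_1:
  assumes "grothendieck_inequality K"
  shows "1 \<le> K"
proof -
  have "\<bar>s\<bar> \<le> 1 \<Longrightarrow> \<bar>t\<bar> \<le> 1 \<Longrightarrow> \<bar>s * t\<bar> \<le> 1" for s t :: real
    by (simp add: abs_mult mult_le_one)
  then show ?thesis
    using assms[unfolded grothendieck_inequality_def, rule_format,
        of 1 1 "\<lambda>_ _. 1" "\<lambda>_ _. 1" 1 "\<lambda>_ _. 1"]
    by (simp add: L2_set_def)
qed

text \<open>
  The inequality of Grothendieck in basis-free form, obtained by numbering the two index types and
  an orthonormal basis.
\<close>

lemma grothendieck_inequality_euclidean:
  fixes A :: "real ^ 'n ^ 'm" and u :: "'m \<Rightarrow> 'h::euclidean_space" and v :: "'n \<Rightarrow> 'h"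
  assumes K: "grothendieck_inequality K"
    and A: "\<And>s t. (\<And>i. \<bar>s i\<bar> \<le> 1) \<Longrightarrow> (\<And>j. \<bar>t j\<bar> \<le> 1) \<Longrightarrow>
              \<bar>\<Sum>i\<in>UNIV. \<Sum>j\<in>UNIV. A $ i $ j * s i * t j\<bar> \<le> 1"
    and u: "\<And>i. norm (u i) \<le> 1" and v: "\<And>j. norm (v j) \<le> 1"
  shows "\<bar>\<Sum>i\<in>UNIV. \<Sum>j\<in>UNIV. A $ i $ j * (u i \<bullet> v j)\<bar> \<le> K"
proof -
  obtain f where f: "bij_betw f {..<CARD('m)} (UNIV :: 'm set)"
    using ex_bij_betw_nat_finite[of "UNIV :: 'm set"] by (auto simp: atLeast0LessThan)
  obtain g where g: "bij_betw g {..<CARD('n)} (UNIV :: 'n set)"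
    using ex_bij_betw_nat_finite[of "UNIV :: 'n set"] by (auto simp: atLeast0LessThan)
  obtain b where b: "bij_betw b {..<DIM('h)} (Basis :: 'h set)"
    using ex_bij_betw_nat_finite[of "Basis :: 'h set"] by (auto simp: atLeast0LessThan)
  have reindex: "(\<Sum>i<CARD('m). \<Sum>j<CARD('n). F (f i) (g j)) = (\<Sum>i\<in>UNIV. \<Sum>j\<in>UNIV. F i j)"
    for F :: "'m \<Rightarrow> 'n \<Rightarrow> real"
    using sum.reindex_bij_betw[OF f, of "\<lambda>i. \<Sum>j\<in>UNIV. F i j"]
    by (simp add: sum.reindex_bij_betw[OF g])
  have inner: "(\<Sum>k<DIM('h). (x \<bullet> b k) * (y \<bullet> b k)) = x \<bullet> y" for x y :: 'h
    using sum.reindex_bij_betw[OF b, of "\<lambda>e. (x \<bullet> e) * (y \<bullet> e)"] by (simp flip: euclidean_inner)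
  have L2: "L2_set (\<lambda>k. x \<bullet> b k) {..<DIM('h)} = norm x" for x :: 'h
    using inner[of x x] by (simp add: L2_set_def norm_eq_sqrt_inner power2_eq_square)
  have form: "\<bar>\<Sum>i<CARD('m). \<Sum>j<CARD('n). A $ f i $ g j * s i * t j\<bar> \<le> 1"
    if s: "\<forall>i<CARD('m). \<bar>s i\<bar> \<le> 1" and t: "\<forall>j<CARD('n). \<bar>t j\<bar> \<le> 1" for s t :: "nat \<Rightarrow> real"
  proof -
    define f' where "f' = the_inv_into {..<CARD('m)} f"
    define g' where "g' = the_inv_into {..<CARD('n)} g"
    have f': "f' i < CARD('m)" for i
      using bij_betwE[OF bij_betw_the_inv_into[OF f]] by (auto simp: f'_def)
    have g': "g' j < CARD('n)" for j
      using bij_betwE[OF bij_betw_the_inv_into[OF g]] by (auto simp: g'_def)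
    have "f' (f i) = i" if "i < CARD('m)" for i
      using f that by (simp add: f'_def the_inv_into_f_f bij_betw_def)
    moreover have "g' (g j) = j" if "j < CARD('n)" for j
      using g that by (simp add: g'_def the_inv_into_f_f bij_betw_def)
    ultimately have "(\<Sum>i<CARD('m). \<Sum>j<CARD('n). A $ f i $ g j * s i * t j)
        = (\<Sum>i<CARD('m). \<Sum>j<CARD('n). A $ f i $ g j * s (f' (f i)) * t (g' (g j)))"
      by (intro sum.cong) auto
    also have "\<dots> = (\<Sum>i\<in>UNIV. \<Sum>j\<in>UNIV. A $ i $ j * s (f' i) * t (g' j))"
      by (rule reindex)
    finally show ?thesis using A[of "\<lambda>i. s (f' i)" "\<lambda>j. t (g' j)"] s t f' g' by simp
  qed
  have "\<bar>\<Sum>i<CARD('m). \<Sum>j<CARD('n). A $ f i $ g j *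
      (\<Sum>k<DIM('h). (u (f i) \<bullet> b k) * (v (g j) \<bullet> b k))\<bar> \<le> K"
    using K[unfolded grothendieck_inequality_def, rule_format, OF form,
        of "\<lambda>i k. u (f i) \<bullet> b k" "DIM('h)" "\<lambda>j k. v (g j) \<bullet> b k"] u v
    by (simp add: L2)
  then show ?thesis
    unfolding inner using reindex[of "\<lambda>i j. A $ i $ j * (u i \<bullet> v j)"] by simp
qed

definition elementary_tensors :: "(real ^ 'n ^ 'm) set" where
  "elementary_tensors = {tensor x y | x y. infnorm x \<le> 1 \<and> infnorm y \<le> 1}"

lemma infnorm_le_1_iff_cbox: "infnorm (x :: real ^ 'n) \<le> 1 \<longleftrightarrow> x \<in> cbox (-1) 1"
  by (auto simp: infnorm_le_iff_cart mem_box_cart abs_le_iff minus_le_iff)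

lemma compact_elementary_tensors: "compact (elementary_tensors :: (real ^ 'n ^ 'm) set)"
proof -
  let ?B = "cbox (-1) 1 :: (real ^ 'n) set" and ?C = "cbox (-1) 1 :: (real ^ 'm) set"
  have "elementary_tensors = (\<lambda>(x, y). tensor x y) ` (?B \<times> ?C)"
    by (auto simp: elementary_tensors_def image_iff infnorm_le_1_iff_cbox)
  moreover have "continuous_on (?B \<times> ?C) (\<lambda>(x, y). tensor x y)"
    unfolding tensor_def case_prod_beta
    by (intro continuous_on_vec_lambda continuous_intros)
  ultimately show ?thesis by (metis compact_continuous_image compact_Times compact_cbox)
qed

lemma inner_matrix: "A \<bullet> T = (\<Sum>i\<in>UNIV. \<Sum>j\<in>UNIV. A $ i $ j * T $ i $ j)" for A T :: "real ^ 'n ^ 'm"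
  by (simp add: inner_vec_def)

text \<open>
  Otherwise a functional \<open>A\<close> separates the matrix from the hull. Being bounded by \<open>b\<close> on the
  elementary tensors means that \<open>A / b\<close> satisfies the hypothesis of the inequality of Grothendieck;
  its conclusion for \<open>u\<close>, \<open>v\<close> then contradicts the separation.
\<close>

lemma hilbert_matrix_in_tensor_hull:
  fixes u :: "'m::finite \<Rightarrow> 'h::euclidean_space" and v :: "'n::finite \<Rightarrow> 'h"
  assumes K: "grothendieck_inequality K"
    and u: "\<And>i. norm (u i) \<le> 1" and v: "\<And>j. norm (v j) \<le> 1"
  shows "(\<chi> i j. (u i \<bullet> v j) / K) \<in> convex hull (elementary_tensors :: (real ^ 'n ^ 'm) set)"
    (is "?T \<in> ?C")
proof (rule ccontr)
  assume "?T \<notin> ?C"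
  moreover have "closed ?C"
    by (intro compact_imp_closed compact_convex_hull compact_elementary_tensors)
  ultimately obtain A' b' where "A' \<bullet> ?T < b'" and "\<forall>x\<in>?C. A' \<bullet> x > b'"
    using separating_hyperplane_closed_point[of ?C ?T] by (metis convex_convex_hull)
  then obtain A b where T: "A \<bullet> ?T > b" and C: "\<And>x. x \<in> ?C \<Longrightarrow> A \<bullet> x < b"
    using that[of "- b'" "- A'"] by auto
  have tensor: "A \<bullet> tensor x y < b" if "infnorm x \<le> 1" "infnorm y \<le> 1" for x y
    using that by (intro C hull_inc) (auto simp: elementary_tensors_def)
  have "0 < b"
    using tensor[of 0 0] by (simp add: infnorm_0 inner_matrix tensor_def)
  have half: "(\<Sum>i\<in>UNIV. \<Sum>j\<in>UNIV. A $ i $ j * s i * t j) < b"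
    if "\<And>i. \<bar>s i\<bar> \<le> 1" "\<And>j. \<bar>t j\<bar> \<le> 1" for s t
    using tensor[of "\<chi> j. t j" "\<chi> i. s i"] that
    by (simp add: infnorm_le_iff_cart inner_matrix tensor_def mult.assoc)
  have form: "\<bar>\<Sum>i\<in>UNIV. \<Sum>j\<in>UNIV. ((1 / b) *\<^sub>R A) $ i $ j * s i * t j\<bar> \<le> 1"
    if s: "\<And>i. \<bar>s i\<bar> \<le> 1" and t: "\<And>j. \<bar>t j\<bar> \<le> 1" for s t
  proof -
    \<comment> \<open>The set of elementary tensors is symmetric, so the one-sided bound holds for absolute values.\<close>
    have "\<bar>\<Sum>i\<in>UNIV. \<Sum>j\<in>UNIV. A $ i $ j * s i * t j\<bar> \<le> b"
      using half[of s t] half[of "\<lambda>i. - s i" t] s t by (simp add: sum_negf abs_le_iff)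
    moreover have "(\<Sum>i\<in>UNIV. \<Sum>j\<in>UNIV. ((1 / b) *\<^sub>R A) $ i $ j * s i * t j)
        = (\<Sum>i\<in>UNIV. \<Sum>j\<in>UNIV. A $ i $ j * s i * t j) / b"
      by (simp add: sum_divide_distrib)
    ultimately show ?thesis using \<open>0 < b\<close> by simp
  qed
  have "1 \<le> K" by (rule grothendieck_inequality_ge_1[OF K])
  have "(A \<bullet> ?T) * K / b = (\<Sum>i\<in>UNIV. \<Sum>j\<in>UNIV. ((1 / b) *\<^sub>R A) $ i $ j * (u i \<bullet> v j))"
    using \<open>1 \<le> K\<close> by (simp add: inner_matrix sum_divide_distrib sum_distrib_right)
  also have "\<dots> \<le> K"
    by (rule abs_le_D1, rule grothendieck_inequality_euclidean[OF K]) (fact form u v)+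
  finally show False using T \<open>0 < b\<close> \<open>1 \<le> K\<close> by (simp add: field_simps)
qed

lemma tensor_scaleR_left: "tensor (c *\<^sub>R x) y = c *\<^sub>R tensor x y"
  by (simp add: tensor_def vec_eq_iff)

lemma tensor_zero_left: "tensor 0 y = 0"
  by (simp add: tensor_def vec_eq_iff)

lemma ex_tensor_series_of_hull:
  fixes T :: "real ^ 'n ^ 'm"
  assumes "T \<in> convex hull elementary_tensors" and "0 \<le> c"
  shows "\<exists>s x y. s \<le> c \<and> (\<lambda>k. tensor (x k) (y k)) sums (c *\<^sub>R T) \<and>
           (\<lambda>k. infnorm (x k) * infnorm (y k)) sums s"
proof -
  obtain N a E where a: "\<And>k. k \<in> {1..N::nat} \<Longrightarrow> 0 \<le> a k"
    and E: "\<And>k. k \<in> {1..N} \<Longrightarrow> E k \<in> (elementary_tensors :: (real ^ 'n ^ 'm) set)"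
    and a1: "sum a {1..N} = 1" and T: "(\<Sum>k=1..N. a k *\<^sub>R E k) = T"
    using assms(1) unfolding convex_hull_indexed by blast
  have "\<forall>k\<in>{1..N}. \<exists>x y. E k = tensor x y \<and> infnorm x \<le> 1 \<and> infnorm y \<le> 1"
    using E by (auto simp: elementary_tensors_def)
  then obtain x y where xy: "\<And>k. k \<in> {1..N} \<Longrightarrow> E k = tensor (x k) (y k)"
    and x: "\<And>k. k \<in> {1..N} \<Longrightarrow> infnorm (x k) \<le> 1" and y: "\<And>k. k \<in> {1..N} \<Longrightarrow> infnorm (y k) \<le> 1"
    by metis
  define x' where "x' k = (if k \<in> {1..N} then (c * a k) *\<^sub>R x k else 0)" for k
  have "(\<lambda>k. tensor (x' k) (y k)) sums (\<Sum>k=1..N. tensor (x' k) (y k))"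
    by (intro sums_finite) (auto simp: x'_def tensor_zero_left)
  moreover have "(\<Sum>k=1..N. tensor (x' k) (y k)) = c *\<^sub>R T"
    unfolding T[symmetric] scaleR_sum_right
    by (intro sum.cong) (auto simp: x'_def xy tensor_scaleR_left)
  moreover have "(\<lambda>k. infnorm (x' k) * infnorm (y k)) sums (\<Sum>k=1..N. infnorm (x' k) * infnorm (y k))"
    by (intro sums_finite) (auto simp: x'_def infnorm_0)
  moreover have "(\<Sum>k=1..N. infnorm (x' k) * infnorm (y k)) \<le> c"
  proof -
    have "infnorm (x' k) * infnorm (y k) \<le> c * a k" if "k \<in> {1..N}" for k
    proof -
      have "infnorm (x k) * infnorm (y k) \<le> 1"
        using x[OF that] y[OF that] by (intro mult_le_one infnorm_pos_le)
      then have "(c * a k) * (infnorm (x k) * infnorm (y k)) \<le> (c * a k) * 1"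
        using a[OF that] \<open>0 \<le> c\<close> by (intro mult_left_mono) auto
      then show ?thesis
        using that a[OF that] \<open>0 \<le> c\<close> by (simp add: x'_def infnorm_mul mult.assoc)
    qed
    then have "(\<Sum>k=1..N. infnorm (x' k) * infnorm (y k)) \<le> (\<Sum>k=1..N. c * a k)"
      by (rule sum_mono)
    also have "\<dots> = c" using a1 by (simp flip: sum_distrib_left)
    finally show ?thesis .
  qed
  ultimately show ?thesis by metis
qed

lemma ex_tensor_series_of_factorization:
  fixes T :: "real ^ 'n ^ 'm" and u :: "'m \<Rightarrow> 'h::euclidean_space"
  assumes K: "grothendieck_inequality K" and "0 < \<alpha>" and "0 < \<beta>"
    and T: "\<And>i j. T $ i $ j = u i \<bullet> v j"
    and u: "\<And>i. norm (u i) \<le> \<alpha>" and v: "\<And>j. norm (v j) \<le> \<beta>"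
  shows "\<exists>s x y. s \<le> K * (\<alpha> * \<beta>) \<and> (\<lambda>k. tensor (x k) (y k)) sums T \<and>
           (\<lambda>k. infnorm (x k) * infnorm (y k)) sums s"
proof -
  have "1 \<le> K" by (rule grothendieck_inequality_ge_1[OF K])
  have "(\<chi> i j. (((1 / \<alpha>) *\<^sub>R u i) \<bullet> ((1 / \<beta>) *\<^sub>R v j)) / K)
      \<in> convex hull (elementary_tensors :: (real ^ 'n ^ 'm) set)"
    using u v \<open>0 < \<alpha>\<close> \<open>0 < \<beta>\<close> by (intro hilbert_matrix_in_tensor_hull[OF K]) auto
  moreover have "(K * (\<alpha> * \<beta>)) *\<^sub>R (\<chi> i j. (((1 / \<alpha>) *\<^sub>R u i) \<bullet> ((1 / \<beta>) *\<^sub>R v j)) / K) = T"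
    using \<open>1 \<le> K\<close> \<open>0 < \<alpha>\<close> \<open>0 < \<beta>\<close> by (simp add: vec_eq_iff T)
  ultimately show ?thesis
    using ex_tensor_series_of_hull[of _ "K * (\<alpha> * \<beta>)"] \<open>1 \<le> K\<close> \<open>0 < \<alpha>\<close> \<open>0 < \<beta>\<close> by fastforce
qed

section \<open>Factorization through a balanced design\<close>

text \<open>
  This is the matrix \<open>\<Sum>\<^sub>i \<lambda>\<^sub>i T\<^sub>i T\<^sub>i\<^sup>t + \<delta> I\<close>, where \<open>T\<^sub>i\<close> is row \<open>i\<close> of \<open>T\<close>: in the theory of optimal
  designs, the regularized information matrix of the design \<open>\<lambda>\<close>. The term \<open>\<delta> I\<close> makes it
  invertible for all weights, even those at the boundary of the simplex and for \<open>T\<close> of deficient rank.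
\<close>

definition design_matrix :: "real ^ 'n ^ 'm \<Rightarrow> real \<Rightarrow> real ^ 'm \<Rightarrow> real ^ 'n ^ 'n" where
  "design_matrix T \<delta> lam =
     (\<chi> a b. (\<Sum>i\<in>UNIV. lam $ i * T $ i $ a * T $ i $ b) + (if a = b then \<delta> else 0))"

lemma design_matrix_mult:
  "design_matrix T \<delta> lam *v w = (\<Sum>i\<in>UNIV. (lam $ i * (T $ i \<bullet> w)) *\<^sub>R T $ i) + \<delta> *\<^sub>R w"
proof -
  have "(design_matrix T \<delta> lam *v w) $ a
      = (\<Sum>b\<in>UNIV. \<Sum>i\<in>UNIV. lam $ i * T $ i $ a * T $ i $ b * w $ b) + \<delta> * w $ a" for a
    by (simp add: design_matrix_def matrix_vector_mult_def distrib_right sum.distrib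
        sum_distrib_right if_distribR if_distrib[of "\<lambda>x. x * _"] cong: if_cong)
  then show ?thesis
    by (subst (asm) sum.swap)
       (simp add: vec_eq_iff inner_vec_def sum_distrib_left mult_ac)
qed

lemma inner_design_matrix_mult:
  "w \<bullet> (design_matrix T \<delta> lam *v w) = (\<Sum>i\<in>UNIV. lam $ i * (T $ i \<bullet> w)\<^sup>2) + \<delta> * (w \<bullet> w)"
  by (simp add: design_matrix_mult inner_add_right inner_sum_right power2_eq_square
      inner_commute mult_ac)

lemma inner_design_matrix_mult_nonneg:
  assumes "\<And>i. 0 \<le> lam $ i" and "0 < \<delta>"
  shows "0 \<le> w \<bullet> (design_matrix T \<delta> lam *v w)"
  unfolding inner_design_matrix_mult using assms by (intro add_nonneg_nonneg sum_nonneg) auto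

lemma det_design_matrix_nonzero:
  assumes "\<And>i. 0 \<le> lam $ i" and "0 < \<delta>"
  shows "det (design_matrix T \<delta> lam) \<noteq> 0"
proof -
  have "w = 0" if "design_matrix T \<delta> lam *v w = 0" for w
  proof -
    have "(\<Sum>i\<in>UNIV. lam $ i * (T $ i \<bullet> w)\<^sup>2) + \<delta> * (w \<bullet> w) = 0"
      using inner_design_matrix_mult[of w T \<delta> lam] that by simp
    moreover have "(\<Sum>i\<in>UNIV. lam $ i * (T $ i \<bullet> w)\<^sup>2) \<ge> 0"
      using assms by (intro sum_nonneg) auto
    moreover have "\<delta> * (w \<bullet> w) \<ge> 0" using assms by simp
    ultimately have "\<delta> * (w \<bullet> w) = 0" by linarith
    with assms show ?thesis by simp
  qed
  then have "\<exists>B. B ** design_matrix T \<delta> lam = mat 1"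
    unfolding matrix_left_invertible_ker by blast
  then show ?thesis by (simp add: invertible_left_inverse flip: invertible_det_nz)
qed

text \<open>
  This is \<open>D\<^sup>-\<^sup>1 T\<^sub>i\<close> for the design matrix \<open>D\<close>. Cramer's rule makes its continuity in the weights
  visible.
\<close>

definition design_solution :: "real ^ 'n ^ 'm \<Rightarrow> real \<Rightarrow> real ^ 'm \<Rightarrow> 'm \<Rightarrow> real ^ 'n" where
  "design_solution T \<delta> lam i =
     (\<chi> k. det (\<chi> a b. if b = k then T $ i $ a else design_matrix T \<delta> lam $ a $ b)
           / det (design_matrix T \<delta> lam))"

lemma design_solution:
  assumes "\<And>i. 0 \<le> lam $ i" and "0 < \<delta>"
  shows "design_matrix T \<delta> lam *v design_solution T \<delta> lam i = T $ i"
  unfolding cramer[OF det_design_matrix_nonzero[of lam \<delta> T, OF assms]] design_solution_def by simp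

lemma continuous_on_design_solution:
  assumes "0 < \<delta>"
  shows "continuous_on {lam. \<forall>i. 0 \<le> lam $ i} (\<lambda>lam. design_solution T \<delta> lam i)"
proof -
  have det: "continuous_on X (\<lambda>lam. det (M lam))"
    if "\<And>a b. continuous_on X (\<lambda>lam. M lam $ a $ b)" for X and M :: "real ^ 'm \<Rightarrow> real ^ 'n ^ 'n"
    unfolding det_def by (intro continuous_intros that)
  have entry: "continuous_on X (\<lambda>lam. design_matrix T \<delta> lam $ a $ b)" for X a b
    unfolding design_matrix_def by (auto intro!: continuous_intros)
  have column: "continuous_on X
      (\<lambda>lam. if b = k then T $ i $ a else design_matrix T \<delta> lam $ a $ b)" for X a b k
    by (cases "b = k") (auto intro: entry)
  show ?thesis
    unfolding design_solution_def using assms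
    by (intro continuous_on_vec_lambda continuous_on_divide det)
       (auto intro: entry column simp: det_design_matrix_nonzero)
qed

text \<open>
  The leverage score \<open>\<langle>T\<^sub>i, D\<^sup>-\<^sup>1 T\<^sub>i\<rangle>\<close> is the squared length of \<open>D\<^sup>-\<^sup>1 T\<^sub>i\<close> in the inner product of \<open>D\<close>.
\<close>

definition leverage :: "real ^ 'n ^ 'm \<Rightarrow> real \<Rightarrow> real ^ 'm \<Rightarrow> 'm \<Rightarrow> real" where
  "leverage T \<delta> lam i = T $ i \<bullet> design_solution T \<delta> lam i"

lemma leverage_nonneg:
  assumes "\<And>i. 0 \<le> lam $ i" and "0 < \<delta>"
  shows "0 \<le> leverage T \<delta> lam i"
  using inner_design_matrix_mult_nonneg[OF assms, where w = "design_solution T \<delta> lam i" and T = T]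
  by (simp add: design_solution[OF assms] leverage_def inner_commute)

text \<open>
  The left-hand side is the trace of \<open>D\<^sup>-\<^sup>1 (D - \<delta> I) = I - \<delta> D\<^sup>-\<^sup>1\<close> on the row space of \<open>T\<close>. Each
  diagonal entry of this operator in an orthonormal basis of the row space is at most 1, as \<open>D\<^sup>-\<^sup>1\<close>
  is positive, and there are \<open>rank T\<close> of them.
\<close>

lemma weighted_leverage_le_rank:
  fixes T :: "real ^ 'n ^ 'm"
  assumes lam: "\<And>i. 0 \<le> lam $ i" and \<delta>: "0 < \<delta>"
  shows "(\<Sum>i\<in>UNIV. lam $ i * leverage T \<delta> lam i) \<le> real (rank T)"
proof -
  let ?D = "design_matrix T \<delta> lam" and ?w = "design_solution T \<delta> lam"
  obtain B where orth: "pairwise orthogonal B" and norm1: "\<And>e. e \<in> B \<Longrightarrow> norm e = 1"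
    and "independent B" and card: "card B = dim (span (rows T))" and span: "span B = span (rows T)"
    using orthonormal_basis_subspace[OF subspace_span[of "rows T"]] by metis
  have fin: "finite B" using \<open>independent B\<close> independent_imp_finite by blast
  have row: "T $ i \<in> span B" for i
    unfolding span by (rule span_base) (auto simp: rows_def row_def)
  have parseval: "T $ i \<bullet> w = (\<Sum>e\<in>B. (T $ i \<bullet> e) * (e \<bullet> w))" for i w
    by (subst orthonormal_basis_expand[OF orth norm1 row fin, symmetric, of i])
       (auto simp: inner_sum_left)
  \<comment> \<open>\<open>z e = D\<^sup>-\<^sup>1 (D - \<delta> I) e\<close>\<close>
  define z where "z e = (\<Sum>i\<in>UNIV. (lam $ i * (T $ i \<bullet> e)) *\<^sub>R ?w i)" for e
  have z: "e \<bullet> z e \<le> 1" if "e \<in> B" for e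
  proof -
    have "?D *v z e = (\<Sum>i\<in>UNIV. (lam $ i * (T $ i \<bullet> e)) *\<^sub>R T $ i)"
      unfolding z_def
      by (simp add: linear_sum[OF matrix_vector_mul_linear] matrix_vector_mult_scaleR
          design_solution[OF lam \<delta>])
    then have "?D *v (e - z e) = \<delta> *\<^sub>R e"
      by (simp add: matrix_vector_mult_diff_distrib design_matrix_mult[of T \<delta> lam e])
    then have "0 \<le> \<delta> * ((e - z e) \<bullet> e)"
      using inner_design_matrix_mult_nonneg[OF lam \<delta>, where w = "e - z e" and T = T] by simp
    then have "0 \<le> (e - z e) \<bullet> e" using \<delta> by (simp add: zero_le_mult_iff)
    then show ?thesis
      using norm1[OF that] by (simp add: inner_diff_left inner_diff_right inner_commute norm_eq_1)
  qed
  have "(\<Sum>i\<in>UNIV. lam $ i * leverage T \<delta> lam i)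
      = (\<Sum>i\<in>UNIV. \<Sum>e\<in>B. lam $ i * ((T $ i \<bullet> e) * (e \<bullet> ?w i)))"
    unfolding leverage_def by (subst parseval) (simp add: sum_distrib_left)
  also have "\<dots> = (\<Sum>e\<in>B. e \<bullet> z e)"
    by (subst sum.swap) (simp add: z_def inner_sum_right mult_ac)
  also have "\<dots> \<le> (\<Sum>e\<in>B. 1)" by (intro sum_mono z)
  finally show ?thesis using card by (simp add: row_rank_def)
qed

text \<open>
  Move the weights to \<open>\<lambda>\<^sub>i \<sigma>\<^sub>i + \<epsilon>\<close>, rescaled by their total \<open>s = \<Sum>\<^sub>k \<lambda>\<^sub>k \<sigma>\<^sub>k + m \<epsilon>\<close>. At a fixed point
  \<open>\<lambda>\<^sub>i s = \<lambda>\<^sub>i \<sigma>\<^sub>i + \<epsilon>\<close>, which forces \<open>\<lambda>\<^sub>i > 0\<close> and then \<open>\<sigma>\<^sub>i \<le> s\<close>. Without \<open>\<epsilon>\<close> a fixed point could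
  have \<open>\<lambda>\<^sub>i = 0\<close>, which says nothing about \<open>\<sigma>\<^sub>i\<close>.
\<close>

lemma ex_balanced_design:
  fixes T :: "real ^ 'n ^ 'm"
  assumes \<delta>: "0 < \<delta>" and \<epsilon>: "0 < \<epsilon>"
  shows "\<exists>lam. (\<forall>i. 0 \<le> lam $ i) \<and> (\<Sum>i\<in>UNIV. lam $ i) = 1 \<and>
           (\<forall>i. leverage T \<delta> lam i \<le> real (rank T) + real CARD('m) * \<epsilon>)"
proof -
  define S :: "(real ^ 'm) set" where "S = {lam. (\<forall>i. 0 \<le> lam $ i) \<and> (\<Sum>i\<in>UNIV. lam $ i) = 1}"
  define total where
    "total lam = (\<Sum>k\<in>UNIV. lam $ k * leverage T \<delta> lam k) + real CARD('m) * \<epsilon>" for lam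
  define f where "f lam = (\<chi> i. (lam $ i * leverage T \<delta> lam i + \<epsilon>) / total lam)" for lam
  have pos: "0 \<le> lam $ i" if "lam \<in> S" for lam i using that by (auto simp: S_def)
  have total_pos: "0 < total lam" if "lam \<in> S" for lam
    unfolding total_def using pos[OF that] \<delta> \<epsilon>
    by (intro add_nonneg_pos sum_nonneg mult_nonneg_nonneg leverage_nonneg) auto
  have "lam $ i \<le> 1" if "lam \<in> S" for lam i
    using that member_le_sum[of i UNIV "\<lambda>i. lam $ i"] by (auto simp: S_def)
  then have "S \<subseteq> cbox 0 1" using pos by (auto simp: mem_box_cart)
  then have "bounded S" using bounded_cbox bounded_subset by blast
  moreover have "closed S"
    unfolding S_def
    by (intro closed_Collect_conj closed_Collect_all closed_Collect_le closed_Collect_eq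
        continuous_intros)
  ultimately have "compact S" by (simp add: compact_eq_bounded_closed)
  moreover have "convex S"
    unfolding S_def convex_def
    by (auto simp: sum.distrib simp flip: sum_distrib_left)
  moreover have "S \<noteq> {}"
  proof -
    have "(\<chi> i. 1 / real CARD('m)) \<in> S" by (simp add: S_def)
    then show ?thesis by blast
  qed
  moreover have "continuous_on S f"
  proof -
    have "continuous_on S (\<lambda>lam. leverage T \<delta> lam i)" for i
      unfolding leverage_def
      by (intro continuous_intros continuous_on_subset[OF continuous_on_design_solution[OF \<delta>]])
         (auto simp: S_def)
    then show ?thesis
      unfolding f_def total_def using total_pos
      by (intro continuous_on_vec_lambda continuous_intros) (auto simp: total_def less_le)
  qed
  moreover have "f \<in> S \<rightarrow> S"
  proof
    fix lam assume "lam \<in> S"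
    have "(\<Sum>i\<in>UNIV. f lam $ i) = (\<Sum>i\<in>UNIV. lam $ i * leverage T \<delta> lam i + \<epsilon>) / total lam"
      by (simp add: f_def sum_divide_distrib)
    also have "\<dots> = 1" using total_pos[OF \<open>lam \<in> S\<close>] by (simp add: total_def sum.distrib)
    finally show "f lam \<in> S"
      using total_pos[OF \<open>lam \<in> S\<close>] pos[OF \<open>lam \<in> S\<close>] \<delta> \<epsilon>
      by (auto simp: S_def f_def intro!: divide_nonneg_pos add_nonneg_nonneg mult_nonneg_nonneg
          leverage_nonneg)
  qed
  ultimately obtain lam where lam: "lam \<in> S" and fix_eq: "f lam = lam" by (rule brouwer)
  have "leverage T \<delta> lam i \<le> real (rank T) + real CARD('m) * \<epsilon>" for i
  proof -
    have "f lam $ i = lam $ i" using fix_eq by simp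
    then have eq: "lam $ i * total lam = lam $ i * leverage T \<delta> lam i + \<epsilon>"
      using total_pos[OF lam] by (simp add: f_def field_simps)
    then have "lam $ i \<noteq> 0" using \<epsilon> by auto
    then have "0 < lam $ i" using pos[OF lam, of i] by simp
    moreover have "lam $ i * leverage T \<delta> lam i \<le> lam $ i * total lam" using eq \<epsilon> by simp
    ultimately have "leverage T \<delta> lam i \<le> total lam" by simp
    also have "\<dots> \<le> real (rank T) + real CARD('m) * \<epsilon>"
      unfolding total_def using weighted_leverage_le_rank[OF pos[OF lam] \<delta>, of T] by simp
    finally show ?thesis .
  qed
  with lam show ?thesis by (auto simp: S_def)
qed

text \<open>
  With the inner product \<open>\<langle>z, D z'\<rangle>\<close> the vectors \<open>D\<^sup>-\<^sup>1 T\<^sub>i\<close> and \<open>e\<^sub>j\<close> have inner product \<open>T\<^sub>i\<^sub>j\<close> and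
  squared lengths \<open>\<sigma>\<^sub>i\<close> and \<open>\<Sum>\<^sub>i \<lambda>\<^sub>i T\<^sub>i\<^sub>j\<^sup>2 + \<delta>\<close>. An explicit isometry \<open>h\<close> into \<open>\<real>\<^sup>m \<times> \<real>\<^sup>n\<close> takes the
  place of the square root of \<open>D\<close>.
\<close>

lemma ex_hilbert_factorization:
  fixes T :: "real ^ 'n ^ 'm"
  assumes \<delta>: "0 < \<delta>" and \<epsilon>: "0 < \<epsilon>" and entries: "\<And>i j. \<bar>T $ i $ j\<bar> \<le> t"
  shows "\<exists>(u :: 'm \<Rightarrow> (real ^ 'm) \<times> (real ^ 'n)) v.
           (\<forall>i j. T $ i $ j = u i \<bullet> v j) \<and>
           (\<forall>i. norm (u i) \<le> sqrt (real (rank T) + real CARD('m) * \<epsilon>)) \<and>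
           (\<forall>j. norm (v j) \<le> sqrt (t\<^sup>2 + \<delta>))"
proof -
  obtain lam where lam: "\<And>i. 0 \<le> lam $ i" and sum1: "(\<Sum>i\<in>UNIV. lam $ i) = 1"
    and lev: "\<And>i. leverage T \<delta> lam i \<le> real (rank T) + real CARD('m) * \<epsilon>"
    using ex_balanced_design[OF \<delta> \<epsilon>, of T] by blast
  define w where "w = design_solution T \<delta> lam"
  define h :: "real ^ 'n \<Rightarrow> (real ^ 'm) \<times> (real ^ 'n)"
    where "h z = (\<chi> k. sqrt (lam $ k) * (T $ k \<bullet> z), sqrt \<delta> *\<^sub>R z)" for z
  have h: "h z \<bullet> h z' = z' \<bullet> (design_matrix T \<delta> lam *v z)" for z z'
  proof -
    have root: "sqrt a * (sqrt a * x) = a * x" if "0 \<le> a" for a x :: real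
      using that by (simp flip: mult.assoc)
    show ?thesis
      using \<delta> by (simp add: h_def inner_prod_def inner_vec_def[of "vec_lambda _"] design_matrix_mult
          inner_add_right inner_sum_right inner_commute[of z'] mult_ac root lam)
  qed
  have "h (w i) \<bullet> h (axis j 1) = T $ i $ j" for i j
    unfolding h w_def design_solution[OF lam \<delta>] by (simp add: inner_axis')
  moreover have "norm (h (w i)) \<le> sqrt (real (rank T) + real CARD('m) * \<epsilon>)" for i
    unfolding norm_eq_sqrt_inner h using lev[of i]
    by (simp add: w_def design_solution[OF lam \<delta>] leverage_def inner_commute)
  moreover have "norm (h (axis j 1)) \<le> sqrt (t\<^sup>2 + \<delta>)" for j
  proof -
    have "(\<Sum>i\<in>UNIV. lam $ i * (T $ i $ j)\<^sup>2) \<le> (\<Sum>i\<in>UNIV. lam $ i * t\<^sup>2)"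
      using entries lam by (intro sum_mono mult_left_mono abs_le_square_iff[THEN iffD1])
        (auto intro: order_trans[OF entries])
    also have "\<dots> = t\<^sup>2" using sum1 by (simp flip: sum_distrib_right)
    finally show ?thesis
      unfolding norm_eq_sqrt_inner h inner_design_matrix_mult by (simp add: inner_axis inner_axis_axis)
  qed
  ultimately show ?thesis
    by (intro exI[of _ "\<lambda>i. h (w i)"] exI[of _ "\<lambda>j. h (axis j 1)"]) simp
qed

section \<open>Comparison of the norms\<close>

lemma nuclear_norm_infnorm_le:
  fixes T :: "real ^ 'n ^ 'm"
  assumes "(\<lambda>k. tensor (x k) (y k)) sums T" and "(\<lambda>k. infnorm (x k) * infnorm (y k)) sums s"
  shows "nuclear_norm infnorm infnorm T \<le> s"
  unfolding nuclear_norm_def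
proof (rule cInf_lower)
  show "bdd_below {s. \<exists>x y. (\<lambda>k. tensor (x k) (y k)) sums T \<and>
      (\<lambda>k. infnorm (x k) * infnorm (y k)) sums s}"
    by (intro bdd_belowI[of _ 0]) (auto intro: order_trans[OF abs_ge_zero entry_le_tensor_series])
qed (use assms in blast)

text \<open>
  The bound holds with every constant \<open>K\<close> of the inequality of Grothendieck, hence with their infimum.
\<close>

lemma nuclear_norm_infnorm_le_factorization:
  fixes T :: "real ^ 'n ^ 'm" and u :: "'m \<Rightarrow> 'h::euclidean_space"
  assumes pos: "0 < \<alpha>" "0 < \<beta>" and T: "\<And>i j. T $ i $ j = u i \<bullet> v j"
    and u: "\<And>i. norm (u i) \<le> \<alpha>" and v: "\<And>j. norm (v j) \<le> \<beta>"
  shows "nuclear_norm infnorm infnorm T \<le> K\<^sub>G * (\<alpha> * \<beta>)"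
proof -
  have "nuclear_norm infnorm infnorm T / (\<alpha> * \<beta>) \<le> K\<^sub>G"
    unfolding grothendieck_constant_def
  proof (rule cInf_greatest)
    show "{K. grothendieck_inequality K} \<noteq> {}" using grothendieck_inequality_128 by blast
    fix K assume "K \<in> {K. grothendieck_inequality K}"
    then have K: "grothendieck_inequality K" by simp
    obtain s x y where "s \<le> K * (\<alpha> * \<beta>)" and "(\<lambda>k. tensor (x k) (y k)) sums T"
      and "(\<lambda>k. infnorm (x k) * infnorm (y k)) sums s"
      using ex_tensor_series_of_factorization[OF K pos T u v] by blast
    then have "nuclear_norm infnorm infnorm T \<le> K * (\<alpha> * \<beta>)"
      using nuclear_norm_infnorm_le[of x y T s] by linarith
    then show "nuclear_norm infnorm infnorm T / (\<alpha> * \<beta>) \<le> K"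
      using pos by (simp add: field_simps)
  qed
  then show ?thesis using pos by (simp add: field_simps)
qed

text \<open>
  The infimum bounds every entry because every series does. That there is a series at all, without
  which the infimum would be an arbitrary number, follows from any of the factorizations.
\<close>

lemma operator_norm_le_nuclear_norm:
  fixes T :: "real ^ 'n ^ 'm"
  shows "operator_norm l1_norm infnorm (\<lambda>z. T *v z) \<le> nuclear_norm infnorm infnorm T"
  unfolding nuclear_norm_def
proof (rule cInf_greatest)
  obtain u :: "'m \<Rightarrow> (real ^ 'm) \<times> (real ^ 'n)" and v where T: "\<And>i j. T $ i $ j = u i \<bullet> v j"
    and u: "\<And>i. norm (u i) \<le> sqrt (real (rank T) + real CARD('m) * 1)"
    and v: "\<And>j. norm (v j) \<le> sqrt ((operator_norm l1_norm infnorm (\<lambda>z. T *v z))\<^sup>2 + 1)"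
    using ex_hilbert_factorization[of 1 1 T, OF _ _ entry_le_operator_norm_l1_infnorm]
    by (metis zero_less_one)
  have "0 < sqrt (real (rank T) + real CARD('m) * 1)" by (simp add: add_nonneg_pos)
  moreover have "0 < sqrt ((operator_norm l1_norm infnorm (\<lambda>z. T *v z))\<^sup>2 + 1)"
    by (simp add: add_nonneg_pos)
  ultimately show "{s. \<exists>x y. (\<lambda>k. tensor (x k) (y k)) sums T \<and>
      (\<lambda>k. infnorm (x k) * infnorm (y k)) sums s} \<noteq> {}"
    using ex_tensor_series_of_factorization[OF grothendieck_inequality_128 _ _ T u v] by blast
qed (auto intro: operator_norm_l1_infnorm_le entry_le_tensor_series)

theorem corollary4p2:
  fixes T :: "real ^ 'n ^ 'm" and r :: nat
  assumes "rank T \<le> r"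
  shows "operator_norm l1_norm infnorm (\<lambda>z. T *v z) \<le> nuclear_norm infnorm infnorm T \<and>
         nuclear_norm infnorm infnorm T
           \<le> K\<^sub>G * sqrt (real r) * operator_norm l1_norm infnorm (\<lambda>z. T *v z)"
proof
  show "operator_norm l1_norm infnorm (\<lambda>z. T *v z) \<le> nuclear_norm infnorm infnorm T"
    by (rule operator_norm_le_nuclear_norm)
  define t where "t = operator_norm l1_norm infnorm (\<lambda>z. T *v z)"
  have entries: "\<bar>T $ i $ j\<bar> \<le> t" for i j
    unfolding t_def by (rule entry_le_operator_norm_l1_infnorm)
  then have "0 \<le> t" using abs_ge_zero order_trans by blast
  have "1 \<le> K\<^sub>G"
    unfolding grothendieck_constant_def
    using grothendieck_inequality_128 grothendieck_inequality_ge_1 by (intro cInf_greatest) auto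
  let ?bound = "\<lambda>\<delta>. K\<^sub>G * (sqrt (real (rank T) + real CARD('m) * \<delta>) * sqrt (t\<^sup>2 + \<delta>))"
  have "nuclear_norm infnorm infnorm T \<le> ?bound \<delta>" if pos: "0 < \<delta>" for \<delta>
  proof -
    obtain u :: "'m \<Rightarrow> (real ^ 'm) \<times> (real ^ 'n)" and v where T: "\<And>i j. T $ i $ j = u i \<bullet> v j"
      and u: "\<And>i. norm (u i) \<le> sqrt (real (rank T) + real CARD('m) * \<delta>)"
      and v: "\<And>j. norm (v j) \<le> sqrt (t\<^sup>2 + \<delta>)"
      using ex_hilbert_factorization[OF pos pos entries] by blast
    from pos have "0 < sqrt (real (rank T) + real CARD('m) * \<delta>)" and "0 < sqrt (t\<^sup>2 + \<delta>)"
      by (auto intro!: add_nonneg_pos)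
    from nuclear_norm_infnorm_le_factorization[OF this T u v] show ?thesis .
  qed
  then have "\<forall>\<^sub>F \<delta> in at_right 0. nuclear_norm infnorm infnorm T \<le> ?bound \<delta>"
    by (intro eventually_mono[OF eventually_at_right_less]) auto
  moreover have "(?bound \<longlongrightarrow> ?bound 0) (at_right 0)"
    by (intro tendsto_intros)
  ultimately have "nuclear_norm infnorm infnorm T \<le> ?bound 0"
    by (intro tendsto_lowerbound) auto
  also have "\<dots> = K\<^sub>G * sqrt (real (rank T)) * t"
    using \<open>0 \<le> t\<close> by simp
  also have "\<dots> \<le> K\<^sub>G * sqrt (real r) * t"
    using assms \<open>1 \<le> K\<^sub>G\<close> \<open>0 \<le> t\<close> by (intro mult_right_mono mult_left_mono) auto
  finally show "nuclear_norm infnorm infnorm T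
      \<le> K\<^sub>G * sqrt (real r) * operator_norm l1_norm infnorm (\<lambda>z. T *v z)"
    by (simp add: t_def)
qed

end
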